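(* Let $\mathcal{I},\mathcal{J}$ be finite nonempty sets, let $\{C_{ij}\}_{i\in\mathcal{I},j\in\mathcal{J}}$ be a family of channels, let $\mu$ be a probability distribution on $\mathcal{I}$ and $\eta$ a probability distribution on $\mathcal{J}$. Then: (a) if all $C_{ij}$ have the same type, then $\bigoplus_{i\leftarrow\mu}\bigoplus_{j\leftarrow\eta}C_{ij}=\bigoplus_{i\leftarrow\mu,\,j\leftarrow\eta}C_{ij}$; (b) if all $C_{ij}$ are compatible, then $\bigsqcup_{i\leftarrow\mu}\bigsqcup_{j\leftarrow\eta}C_{ij}\approx\bigsqcup_{i\leftarrow\mu,\,j\leftarrow\eta}C_{ij}$; (c) if there are a set $\mathcal{X}$ and sets $\mathcal{Y}_j$ ($j\in\mathcal{J}$) such that, for every $i\in\mathcal{I}$ and $j\in\mathcal{J}$, $C_{ij}$ has type $\mathcal{X}\times\mathcal{Y}_j\to\mathbb{R}$, then $\bigoplus_{i\leftarrow\mu}\bigsqcup_{j\leftarrow\eta}C_{ij}\approx\bigsqcup_{j\leftarrow\eta}\bigoplus_{i\leftarrow\mu}C_{ij}$.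
   Context: All input and output sets are finite and nonempty. A channel of type $\mathcal{X}\times\mathcal{Y}\to\mathbb{R}$ is a matrix $C:\mathcal{X}\times\mathcal{Y}\to\mathbb{R}$ with nonnegative entries and $\sum_{y\in\mathcal{Y}}C(x,y)=1$ for all $x\in\mathcal{X}$; $\mathcal{X}$ is its input set and $\mathcal{Y}$ its output set. Channels are compatible if they have the same input set, and have the same type if they have the same input set and the same output set. Hidden choice (for channels $C_k$, $k\in\mathcal{K}$, of the same type and a probability distribution $\nu$ on the finite set $\mathcal{K}$): $\bigoplus_{k\leftarrow\nu}C_k=\sum_{k\in\mathcal{K}}\nu(k)C_k$. Visible choice (for compatible channels $C_k:\mathcal{X}\times\mathcal{Y}_k\to\mathbb{R}$): $\bigsqcup_{k\leftarrow\nu}C_k$ is the channel with input set $\mathcal{X}$ and output set the disjoint union $\{(y,k)\mid k\in\mathcal{K},y\in\mathcal{Y}_k\}$ given by $(x,(y,k))\mapsto\nu(k)C_k(x,y)$. The double-indexed operators $\bigoplus_{i\leftarrow\mu,\,j\leftarrow\eta}$ and $\bigsqcup_{i\leftarrow\mu,\,j\leftarrow\eta}$ are the hidden and visible choice over the index set $\mathcal{I}\times\mathcal{J}$ with the product distribution $(i,j)\mapsto\mu(i)\eta(j)$. $\mathbb{D}\mathcal{X}$ is the set of probability distributions on $\mathcal{X}$. A vulnerability is any continuous convex function $\mathbb{V}:\mathbb{D}\mathcal{X}\to\mathbb{R}$. For a prior $\pi\in\mathbb{D}\mathcal{X}$ and a channel $C:\mathcal{X}\times\mathcal{Y}\to\mathbb{R}$,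 put $p(y)=\sum_{x}\pi(x)C(x,y)$ and, when $p(y)\ne0$, let $p_{X\mid y}\in\mathbb{D}\mathcal{X}$ be $x\mapsto\pi(x)C(x,y)/p(y)$. The posterior vulnerability is $\mathbb{V}[\pi,C]=\sum_{y\in\mathcal{Y},\,p(y)\neq0}p(y)\,\mathbb{V}(p_{X\mid y})$. Two compatible channels $C_1,C_2$ with input set $\mathcal{X}$ are equivalent, written $C_1\approx C_2$, if $\mathbb{V}[\pi,C_1]=\mathbb{V}[\pi,C_2]$ for every $\pi\in\mathbb{D}\mathcal{X}$ and every vulnerability $\mathbb{V}$. *)

theory Defs
  imports "HOL-Analysis.Function_Topology"
begin

text \<open>
  Distributions and channel matrices are total functions that vanish outside their carrier, so
  that HOL equality coincides with equality on the carrier.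
\<close>

definition distributions :: "'a set \<Rightarrow> ('a \<Rightarrow> real) set" where
  "distributions A = {p. (\<forall>a\<in>A. 0 \<le> p a) \<and> (\<Sum>a\<in>A. p a) = 1 \<and> (\<forall>a. a \<notin> A \<longrightarrow> p a = 0)}"

record ('x, 'y) channel =
  inputs :: "'x set"
  outputs :: "'y set"
  entry :: "'x \<Rightarrow> 'y \<Rightarrow> real"

definition is_channel :: "('x, 'y) channel \<Rightarrow> bool" where
  "is_channel C \<longleftrightarrow>
     finite (inputs C) \<and> inputs C \<noteq> {} \<and> finite (outputs C) \<and> outputs C \<noteq> {} \<and>
     (\<forall>x\<in>inputs C. \<forall>y\<in>outputs C. 0 \<le> entry C x y) \<and>
     (\<forall>x\<in>inputs C. (\<Sum>y\<in>outputs C. entry C x y) = 1) \<and>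
     (\<forall>x y. x \<notin> inputs C \<or> y \<notin> outputs C \<longrightarrow> entry C x y = 0)"

definition compatible :: "('x, 'y) channel \<Rightarrow> ('x, 'z) channel \<Rightarrow> bool" where
  "compatible C D \<longleftrightarrow> inputs C = inputs D"

definition same_type :: "('x, 'y) channel \<Rightarrow> ('x, 'y) channel \<Rightarrow> bool" where
  "same_type C D \<longleftrightarrow> inputs C = inputs D \<and> outputs C = outputs D"

text \<open>
  The choice operators are meant for nonempty families of channels of the same type (hidden
  choice) or of compatible channels (visible choice). The unions of the input and output sets
  below are then unions of equal sets, that is, the common input and output set.
\<close>

definition hidden_choice ::
    "'k set \<Rightarrow> ('k \<Rightarrow> real) \<Rightarrow> ('k \<Rightarrow> ('x, 'y) channel) \<Rightarrow> ('x, 'y) channel" where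
  "hidden_choice K \<nu> C =
     \<lparr>inputs = (\<Union>k\<in>K. inputs (C k)),
      outputs = (\<Union>k\<in>K. outputs (C k)),
      entry = (\<lambda>x y. \<Sum>k\<in>K. \<nu> k * entry (C k) x y)\<rparr>"

definition visible_choice ::
    "'k set \<Rightarrow> ('k \<Rightarrow> real) \<Rightarrow> ('k \<Rightarrow> ('x, 'y) channel) \<Rightarrow> ('x, 'y \<times> 'k) channel" where
  "visible_choice K \<nu> C =
     \<lparr>inputs = (\<Union>k\<in>K. inputs (C k)),
      outputs = {(y, k). k \<in> K \<and> y \<in> outputs (C k)},
      entry = (\<lambda>x (y, k). \<nu> k * entry (C k) x y)\<rparr>"

definition product_distribution :: "('i \<Rightarrow> real) \<Rightarrow> ('j \<Rightarrow> real) \<Rightarrow> 'i \<times> 'j \<Rightarrow> real" where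
  "product_distribution \<mu> \<eta> = (\<lambda>(i, j). \<mu> i * \<eta> j)"

text \<open>
  Convexity is spelled out because the function type is not an instance of class
  \<^class>\<open>real_vector\<close>. Continuity refers to the product topology on functions, which for
  finite \<open>X\<close> induces the Euclidean topology on \<open>distributions X\<close>. Only the values of \<open>V\<close> on
  \<open>distributions X\<close> matter.
\<close>

definition vulnerability :: "'x set \<Rightarrow> (('x \<Rightarrow> real) \<Rightarrow> real) \<Rightarrow> bool" where
  "vulnerability X V \<longleftrightarrow>
     continuous_on (distributions X) V \<and>
     (\<forall>p\<in>distributions X. \<forall>q\<in>distributions X. \<forall>u v. 0 \<le> u \<and> 0 \<le> v \<and> u + v = 1 \<longrightarrow>
        V (\<lambda>x. u * p x + v * q x) \<le> u * V p + v * V q)"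

definition output_prob :: "('x \<Rightarrow> real) \<Rightarrow> ('x, 'y) channel \<Rightarrow> 'y \<Rightarrow> real" where
  "output_prob \<pi> C y = (\<Sum>x\<in>inputs C. \<pi> x * entry C x y)"

definition posterior :: "('x \<Rightarrow> real) \<Rightarrow> ('x, 'y) channel \<Rightarrow> 'y \<Rightarrow> 'x \<Rightarrow> real" where
  "posterior \<pi> C y = (\<lambda>x. \<pi> x * entry C x y / output_prob \<pi> C y)"

definition posterior_vulnerability ::
    "(('x \<Rightarrow> real) \<Rightarrow> real) \<Rightarrow> ('x \<Rightarrow> real) \<Rightarrow> ('x, 'y) channel \<Rightarrow> real" where
  "posterior_vulnerability V \<pi> C =
     (\<Sum>y | y \<in> outputs C \<and> output_prob \<pi> C y \<noteq> 0. output_prob \<pi> C y * V (posterior \<pi> C y))"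

definition equivalent :: "('x, 'y) channel \<Rightarrow> ('x, 'z) channel \<Rightarrow> bool" where
  "equivalent C D \<longleftrightarrow> compatible C D \<and>
     (\<forall>\<pi>\<in>distributions (inputs C). \<forall>V. vulnerability (inputs C) V \<longrightarrow>
        posterior_vulnerability V \<pi> C = posterior_vulnerability V \<pi> D)"

lemma product_distribution_in_distributions:
  assumes "\<mu> \<in> distributions I" and "\<eta> \<in> distributions J"
  shows "product_distribution \<mu> \<eta> \<in> distributions (I \<times> J)"
proof -
  have "(\<Sum>(i, j)\<in>I \<times> J. \<mu> i * \<eta> j) = (\<Sum>i\<in>I. \<mu> i) * (\<Sum>j\<in>J. \<eta> j)"
    by (simp add: sum_product sum.cartesian_product)
  then show ?thesis
    using assms by (auto simp: distributions_def product_distribution_def)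
qed

lemma is_channel_hidden_choice:
  fixes C :: "'k \<Rightarrow> ('x, 'y) channel"
  assumes K: "finite K" "K \<noteq> {}" and \<nu>: "\<nu> \<in> distributions K"
    and ch: "\<And>k. k \<in> K \<Longrightarrow> is_channel (C k)"
    and ty: "\<And>k l. k \<in> K \<Longrightarrow> l \<in> K \<Longrightarrow> same_type (C k) (C l)"
  shows "is_channel (hidden_choice K \<nu> C)"
proof -
  obtain k0 where k0: "k0 \<in> K" using K by blast
  define X where "X = inputs (C k0)"
  define Y where "Y = outputs (C k0)"
  have X: "inputs (C k) = X" and Y: "outputs (C k) = Y" if "k \<in> K" for k
    using ty[OF that k0] by (simp_all add: same_type_def X_def Y_def)
  have U: "(\<Union>k\<in>K. inputs (C k)) = X" "(\<Union>k\<in>K. outputs (C k)) = Y"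
    using X Y k0 by auto
  have "(\<Sum>y\<in>Y. \<Sum>k\<in>K. \<nu> k * entry (C k) x y) = 1" if "x \<in> X" for x
  proof -
    have "(\<Sum>y\<in>Y. \<Sum>k\<in>K. \<nu> k * entry (C k) x y) = (\<Sum>k\<in>K. \<nu> k * (\<Sum>y\<in>Y. entry (C k) x y))"
      by (subst sum.swap) (simp add: sum_distrib_left)
    also have "\<dots> = (\<Sum>k\<in>K. \<nu> k)"
      using ch X Y that by (intro sum.cong) (auto simp: is_channel_def)
    finally show ?thesis using \<nu> by (simp add: distributions_def)
  qed
  moreover have "0 \<le> (\<Sum>k\<in>K. \<nu> k * entry (C k) x y)" if "x \<in> X" "y \<in> Y" for x y
    using ch X Y that \<nu> by (intro sum_nonneg mult_nonneg_nonneg) (auto simp: is_channel_def distributions_def)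
  moreover have "(\<Sum>k\<in>K. \<nu> k * entry (C k) x y) = 0" if "x \<notin> X \<or> y \<notin> Y" for x y
    using ch X Y that by (intro sum.neutral) (auto simp: is_channel_def)
  moreover have "finite X" "X \<noteq> {}" "finite Y" "Y \<noteq> {}"
    using ch[OF k0] by (auto simp: is_channel_def X_def Y_def)
  ultimately show ?thesis
    by (simp add: is_channel_def hidden_choice_def U)
qed

lemma is_channel_visible_choice:
  fixes C :: "'k \<Rightarrow> ('x, 'y) channel"
  assumes K: "finite K" "K \<noteq> {}" and \<nu>: "\<nu> \<in> distributions K"
    and ch: "\<And>k. k \<in> K \<Longrightarrow> is_channel (C k)"
    and co: "\<And>k l. k \<in> K \<Longrightarrow> l \<in> K \<Longrightarrow> compatible (C k) (C l)"
  shows "is_channel (visible_choice K \<nu> C)"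
proof -
  obtain k0 where k0: "k0 \<in> K" using K by blast
  define X where "X = inputs (C k0)"
  have X: "inputs (C k) = X" if "k \<in> K" for k
    using co[OF that k0] by (simp add: compatible_def X_def)
  have U: "(\<Union>k\<in>K. inputs (C k)) = X"
    using X k0 by auto
  define Y where "Y = {(y, k). k \<in> K \<and> y \<in> outputs (C k)}"
  have Y: "Y = (\<lambda>(k, y). (y, k)) ` (SIGMA k:K. outputs (C k))"
    by (auto simp: Y_def)
  have fin: "finite (outputs (C k))" if "k \<in> K" for k
    using ch[OF that] by (simp add: is_channel_def)
  have "(\<Sum>z\<in>Y. (\<lambda>(y, k). \<nu> k * entry (C k) x y) z) = 1" if "x \<in> X" for x
  proof -
    have "(\<Sum>z\<in>Y. (\<lambda>(y, k). \<nu> k * entry (C k) x y) z)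
        = (\<Sum>(k, y)\<in>(SIGMA k:K. outputs (C k)). \<nu> k * entry (C k) x y)"
      unfolding Y by (subst sum.reindex) (auto simp: inj_on_def case_prod_unfold)
    also have "\<dots> = (\<Sum>k\<in>K. \<Sum>y\<in>outputs (C k). \<nu> k * entry (C k) x y)"
      using K fin by (subst sum.Sigma) auto
    also have "\<dots> = (\<Sum>k\<in>K. \<nu> k * (\<Sum>y\<in>outputs (C k). entry (C k) x y))"
      by (simp add: sum_distrib_left)
    also have "\<dots> = (\<Sum>k\<in>K. \<nu> k)"
      using ch X that by (intro sum.cong) (auto simp: is_channel_def)
    finally show ?thesis using \<nu> by (simp add: distributions_def)
  qed
  moreover have "0 \<le> (\<lambda>(y, k). \<nu> k * entry (C k) x y) z" if "x \<in> X" "z \<in> Y" for x z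
    using ch X that \<nu> by (auto simp: Y_def is_channel_def distributions_def)
  moreover have "(\<lambda>(y, k). \<nu> k * entry (C k) x y) z = 0" if "x \<notin> X \<or> z \<notin> Y" for x z
  proof -
    obtain y k where z: "z = (y, k)" by (cases z)
    show ?thesis
    proof (cases "k \<in> K")
      case True
      then show ?thesis using ch[OF True] X[OF True] that z by (auto simp: Y_def is_channel_def)
    next
      case False
      then show ?thesis using \<nu> z by (simp add: distributions_def)
    qed
  qed
  moreover have "finite X" "X \<noteq> {}" "finite Y"
    using ch[OF k0] K fin by (auto simp: is_channel_def X_def Y)
  moreover have "Y \<noteq> {}"
    using ch[OF k0] k0 by (auto simp: is_channel_def Y_def)
  ultimately show ?thesis
    by (simp add: is_channel_def visible_choice_def U flip: Y_def)
qed

end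

theory Submission imports Defs begin

text \<open>A posterior vulnerability is a sum over outputs whose terms depend only on the
  corresponding column of the matrix, so renaming outputs bijectively does not change it
  (\<open>equivalent_reindex\<close>). Nested hidden choices collapse because multiplication
  distributes over finite sums and a double sum is a sum over pairs. Nested visible choices differ
  from the double-indexed one only in how the tags i and j are bracketed, which is a renaming. Mixed
  choices tag outputs by j alone in either order, so they give the very same matrix.\<close>

lemma equivalent_reindex:
  fixes C :: "('x, 'y) channel" and D :: "('x, 'z) channel"
  assumes inputs: "inputs C = inputs D"
    and f: "bij_betw f (outputs C) (outputs D)"
    and entry: "\<And>x y. y \<in> outputs C \<Longrightarrow> entry D x (f y) = entry C x y"
  shows "equivalent C D"
proof -
  have "posterior_vulnerability V \<pi> C = posterior_vulnerability V \<pi> D" for V \<pi>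
  proof -
    have prob: "output_prob \<pi> D (f y) = output_prob \<pi> C y" if "y \<in> outputs C" for y
      using that by (simp add: output_prob_def inputs entry)
    have post: "posterior \<pi> D (f y) = posterior \<pi> C y" if "y \<in> outputs C" for y
      using that by (simp add: posterior_def prob entry)
    \<comment> \<open>The sum defining the vulnerability skips outputs of probability zero;
      \<open>f\<close> preserves output probabilities, so it restricts to a bijection between the
      index sets that remain.\<close>
    have "bij_betw f {y. y \<in> outputs C \<and> output_prob \<pi> C y \<noteq> 0}
        {z. z \<in> outputs D \<and> output_prob \<pi> D z \<noteq> 0}"
    proof (rule bij_betw_subset[OF f])
      show "f ` {y. y \<in> outputs C \<and> output_prob \<pi> C y \<noteq> 0} =
          {z. z \<in> outputs D \<and> output_prob \<pi> D z \<noteq> 0}"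
        unfolding bij_betw_imp_surj_on[OF f, symmetric] using prob by auto
    qed auto
    from sum.reindex_bij_betw[OF this, of "\<lambda>z. output_prob \<pi> D z * V (posterior \<pi> D z)"]
    show ?thesis
      by (simp add: posterior_vulnerability_def prob post)
  qed
  with inputs show ?thesis
    by (simp add: equivalent_def compatible_def)
qed

text \<open>The weight \<mu> i moves inside the inner sum; the carriers agree since an iterated
  union is a union over pairs.\<close>

lemma hidden_choice_nested:
  "hidden_choice I \<mu> (\<lambda>i. hidden_choice J \<eta> (\<lambda>j. C i j)) =
    hidden_choice (I \<times> J) (product_distribution \<mu> \<eta>) (\<lambda>(i, j). C i j)"
proof -
  have "(\<Sum>i\<in>I. \<mu> i * (\<Sum>j\<in>J. \<eta> j * entry (C i j) x y)) =
      (\<Sum>(i, j)\<in>I \<times> J. \<mu> i * \<eta> j * entry (C i j) x y)" for x y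
    by (simp add: sum_distrib_left sum.cartesian_product mult.assoc)
  then show ?thesis
    by (simp add: hidden_choice_def product_distribution_def case_prod_unfold) force
qed

text \<open>The two output types differ, so equality cannot even be stated. Rebracketing ((y, j), i)
  as (y, (i, j)) matches the columns, by associativity of the product of weights.\<close>

lemma visible_choice_nested:
  "equivalent
    (visible_choice I \<mu> (\<lambda>i. visible_choice J \<eta> (\<lambda>j. C i j)))
    (visible_choice (I \<times> J) (product_distribution \<mu> \<eta>) (\<lambda>(i, j). C i j))"
proof (rule equivalent_reindex)
  show "bij_betw (\<lambda>((y, j), i). (y, (i, j)))
      (outputs (visible_choice I \<mu> (\<lambda>i. visible_choice J \<eta> (\<lambda>j. C i j))))
      (outputs (visible_choice (I \<times> J) (product_distribution \<mu> \<eta>) (\<lambda>(i, j). C i j)))"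
    by (rule bij_betw_byWitness[where f' = "\<lambda>(y, (i, j)). ((y, j), i)"])
      (auto simp: visible_choice_def)
qed (auto simp: visible_choice_def product_distribution_def)

text \<open>Equality, not just equivalence: the hidden choice over \<open>I\<close> adds no tag, and
  the factor \<eta> j of column (y, j) is independent of i, so it comes out of the sum over
  \<open>I\<close>.\<close>

lemma hidden_visible_choice_commute:
  "hidden_choice I \<mu> (\<lambda>i. visible_choice J \<eta> (\<lambda>j. C i j)) =
    visible_choice J \<eta> (\<lambda>j. hidden_choice I \<mu> (\<lambda>i. C i j))"
  by (auto simp: hidden_choice_def visible_choice_def fun_eq_iff sum_distrib_left mult.left_commute)

theorem proposition6:
  fixes I :: "'i set" and J :: "'j set"
    and C :: "'i \<Rightarrow> 'j \<Rightarrow> ('x, 'y) channel"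
    and \<mu> :: "'i \<Rightarrow> real" and \<eta> :: "'j \<Rightarrow> real"
  assumes "finite I" and "I \<noteq> {}" and "finite J" and "J \<noteq> {}"
    and "\<And>i j. i \<in> I \<Longrightarrow> j \<in> J \<Longrightarrow> is_channel (C i j)"
    and "\<mu> \<in> distributions I" and "\<eta> \<in> distributions J"
  shows
    "((\<forall>i\<in>I. \<forall>j\<in>J. \<forall>i'\<in>I. \<forall>j'\<in>J. same_type (C i j) (C i' j')) \<longrightarrow>
        hidden_choice I \<mu> (\<lambda>i. hidden_choice J \<eta> (\<lambda>j. C i j)) =
        hidden_choice (I \<times> J) (product_distribution \<mu> \<eta>) (\<lambda>(i, j). C i j)) \<and>
     ((\<forall>i\<in>I. \<forall>j\<in>J. \<forall>i'\<in>I. \<forall>j'\<in>J. compatible (C i j) (C i' j')) \<longrightarrow>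
        equivalent
          (visible_choice I \<mu> (\<lambda>i. visible_choice J \<eta> (\<lambda>j. C i j)))
          (visible_choice (I \<times> J) (product_distribution \<mu> \<eta>) (\<lambda>(i, j). C i j))) \<and>
     ((\<exists>X Y. \<forall>i\<in>I. \<forall>j\<in>J. inputs (C i j) = X \<and> outputs (C i j) = Y j) \<longrightarrow>
        equivalent
          (hidden_choice I \<mu> (\<lambda>i. visible_choice J \<eta> (\<lambda>j. C i j)))
          (visible_choice J \<eta> (\<lambda>j. hidden_choice I \<mu> (\<lambda>i. C i j))))"
proof (intro conjI impI)
  show "equivalent
      (hidden_choice I \<mu> (\<lambda>i. visible_choice J \<eta> (\<lambda>j. C i j)))
      (visible_choice J \<eta> (\<lambda>j. hidden_choice I \<mu> (\<lambda>i. C i j)))"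
    \<comment> \<open>Once both sides are the same channel, only reflexivity of
      \<open>equivalent\<close> is left.\<close>
    by (simp add: hidden_visible_choice_commute equivalent_def compatible_def)
qed (rule hidden_choice_nested visible_choice_nested)+

end
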